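(* Let $1<p<\infty$ and let $A\in\mathbb{R}^{n\times n}$ be an invertible matrix such that $A^k=I$ for some $k\in\mathbb{N}$. Then $$\mathcal{A}_{A,p}=\{w\in\mathcal{A}_p:\ w(Ax)\lesssim w(x)\ \text{for a.e. }x\in\mathbb{R}^n\}.$$
   Context: A weight is a locally integrable function $w$ on $\mathbb{R}^n$ with $0<w<\infty$ a.e. Cubes $Q$ have sides parallel to the axes, and $w_A(x)=w(Ax)$. For $1<p<\infty$, a weight $w$ belongs to $\mathcal{A}_{A,p}$ if $[w]_{\mathcal{A}_{A,p}}=\sup_Q \frac1{|Q|}\int_Q w_A(x)\,dx\left(\frac1{|Q|}\int_Q w(x)^{-\frac1{p-1}}\,dx\right)^{p-1}<\infty$; $\mathcal{A}_p=\mathcal{A}_{I,p}$ is the classical Muckenhoupt class. The notation $w(Ax)\lesssim w(x)$ a.e. means that there is a constant $C>0$ with $w(Ax)\le C\,w(x)$ for a.e. $x$. *)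

theory Defs
  imports "HOL-Analysis.Analysis"
begin

definition locally_integrable :: "(real^'n \<Rightarrow> real) \<Rightarrow> bool" where
  "locally_integrable f \<longleftrightarrow> (\<forall>K. compact K \<longrightarrow> set_integrable lebesgue K f)"

(* Weights are real-valued, so finiteness is built into the type; positivity is required
   only almost everywhere, and the values on the exceptional null set are irrelevant. *)
definition weight :: "(real^'n \<Rightarrow> real) \<Rightarrow> bool" where
  "weight w \<longleftrightarrow> locally_integrable w \<and> (AE x in lebesgue. 0 < w x)"

definition cubes :: "(real^'n) set set" where
  "cubes = {cbox a (\<chi> i. a $ i + l) | a l. 0 < l}"

definition average :: "(real^'n) set \<Rightarrow> (real^'n \<Rightarrow> ennreal) \<Rightarrow> ennreal" where
  "average Q f = (\<integral>\<^sup>+x\<in>Q. f x \<partial>lebesgue) / emeasure lebesgue Q"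

(* Real powers on [0, \<infinity>]; used only with a positive exponent, whence \<infinity>^a = \<infinity> and 0^a = 0. *)
definition ennreal_powr :: "ennreal \<Rightarrow> real \<Rightarrow> ennreal" where
  "ennreal_powr x a = (if x = \<infinity> then \<infinity> else ennreal (enn2real x powr a))"

(* The supremum is taken in [0, \<infinity>], since w powr (-1/(p-1)) need not be locally integrable. *)
definition muckenhoupt_const :: "real^'n^'n \<Rightarrow> real \<Rightarrow> (real^'n \<Rightarrow> real) \<Rightarrow> ennreal" where
  "muckenhoupt_const A p w =
     (SUP Q\<in>cubes. average Q (\<lambda>x. ennreal (w (A *v x))) *
        ennreal_powr (average Q (\<lambda>x. ennreal (w x powr (- 1 / (p - 1))))) (p - 1))"

definition muckenhoupt_mat :: "real^'n^'n \<Rightarrow> real \<Rightarrow> (real^'n \<Rightarrow> real) set" where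
  "muckenhoupt_mat A p = {w. weight w \<and> muckenhoupt_const A p w < \<infinity>}"

definition muckenhoupt :: "real \<Rightarrow> (real^'n \<Rightarrow> real) set" where
  "muckenhoupt p = muckenhoupt_mat (mat 1) p"

(* The power operation that the library provides on real^'n^'n is componentwise. *)
primrec matrix_pow :: "real^'n^'n \<Rightarrow> nat \<Rightarrow> real^'n^'n" where
  "matrix_pow A 0 = mat 1"
| "matrix_pow A (Suc k) = A ** matrix_pow A k"

end

theory Submission
  imports Defs
begin

text \<open>
  Averages over small cubes concentrated on a set \<open>{x. s < w (A x), t < w x powr (-1/(p-1))}\<close>
  of positive measure are at least \<open>s/2\<close> and \<open>t/2\<close>. Hence finiteness of the
  constant forces \<open>w (A x) \<le> C w x\<close> almost everywhere, with no need for the Lebesgue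
  differentiation theorem. Invertible matrices preserve null sets, so this can be iterated along
  the finite orbit of \<open>A\<close> to get \<open>w x = w (A\<^sup>k x) \<le> C\<^sup>k\<^sup>-\<^sup>1 w (A x)\<close>.
  Therefore \<open>w\<close> and its composition with \<open>A\<close> are pointwise comparable, and so
  are the two constants.
\<close>

section \<open>Lebesgue sets and null sets under invertible linear maps\<close>

text \<open>The preimage is the image under the inverse matrix, and differentiable maps of the space
  to itself send Lebesgue sets to Lebesgue sets. Continuity alone would only settle Borel
  sets.\<close>

lemma sets_lebesgue_vimage_matrix:
  fixes A :: "real^'n^'n"
  assumes "invertible A" "S \<in> sets lebesgue"
  shows "{x. A *v x \<in> S} \<in> sets lebesgue"
proof -
  obtain B where B: "A ** B = mat 1" "B ** A = mat 1"
    using assms(1) unfolding invertible_def by blast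
  have "{x. A *v x \<in> S} = (\<lambda>y. B *v y) ` S"
  proof safe
    fix x assume "A *v x \<in> S"
    then show "x \<in> (\<lambda>y. B *v y) ` S"
      using B(2) by (intro image_eqI[of _ _ "A *v x"]) (simp_all add: matrix_vector_mul_assoc)
  qed (simp add: matrix_vector_mul_assoc B(1))
  moreover have "(\<lambda>y. B *v y) ` S \<in> sets lebesgue"
    using assms(2)
    by (intro differentiable_image_in_sets_lebesgue linear_imp_differentiable_on) auto
  ultimately show ?thesis by simp
qed

lemma borel_measurable_lebesgue_matrix:
  fixes A :: "real^'n^'n"
  assumes "invertible A" "f \<in> borel_measurable lebesgue"
  shows "(\<lambda>x. f (A *v x)) \<in> borel_measurable lebesgue"
proof (rule measurableI)
  fix S :: "'a set" assume "S \<in> sets borel"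
  then have "f -` S \<in> sets lebesgue"
    using measurable_sets[OF assms(2)] by simp
  from sets_lebesgue_vimage_matrix[OF assms(1) this]
  show "(\<lambda>x. f (A *v x)) -` S \<inter> space lebesgue \<in> sets lebesgue"
    by (simp add: vimage_def)
qed simp

text \<open>The new exceptional set lies in the image of the old one under the inverse matrix, and a
  linear image of a negligible set is negligible.\<close>

lemma AE_lebesgue_matrix:
  fixes A :: "real^'n^'n"
  assumes "invertible A" "AE x in lebesgue. P x"
  shows "AE x in lebesgue. P (A *v x)"
proof -
  obtain B where B: "A ** B = mat 1" "B ** A = mat 1"
    using assms(1) unfolding invertible_def by blast
  obtain N where N: "{x. \<not> P x} \<subseteq> N" "N \<in> null_sets lebesgue"
    using assms(2) by (force elim!: AE_E simp: null_sets_def)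
  have "negligible ((\<lambda>y. B *v y) ` N)"
    using N(2)
    by (intro negligible_differentiable_image_negligible linear_imp_differentiable_on)
       (auto simp: negligible_iff_null_sets)
  moreover have "{x. \<not> P (A *v x)} \<subseteq> (\<lambda>y. B *v y) ` N"
  proof
    fix x assume "x \<in> {x. \<not> P (A *v x)}"
    then show "x \<in> (\<lambda>y. B *v y) ` N"
      using N(1) B(2)
      by (intro image_eqI[of _ _ "A *v x"]) (auto simp: matrix_vector_mul_assoc)
  qed
  ultimately show ?thesis
    by (intro AE_I'[of "(\<lambda>y. B *v y) ` N"]) (auto simp: negligible_iff_null_sets)
qed

lemma invertible_matrix_pow:
  assumes "invertible A"
  shows "invertible (matrix_pow A k)"
  using assms by (induction k) (auto intro: invertible_mult simp: invertible_def[of "mat 1"])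

section \<open>Iterating the pointwise bound along the orbit\<close>

text \<open>Each induction step uses the bound at the point
  \<open>matrix_pow A (Suc k) *v x\<close>, where it still holds almost everywhere because powers of
  \<open>A\<close> are invertible. The chain starts at \<open>A *v x\<close>, not at
  \<open>x\<close>, so that a power equal to the identity bounds \<open>w x\<close> by a multiple of
  \<open>w (A *v x)\<close>.\<close>

lemma AE_le_orbit:
  fixes A :: "real^'n^'n" and w :: "real^'n \<Rightarrow> real"
  assumes "invertible A" "0 \<le> C" "AE x in lebesgue. w (A *v x) \<le> C * w x"
  shows "AE x in lebesgue. w (matrix_pow A (Suc k) *v x) \<le> C ^ k * w (A *v x)"
proof (induction k)
  case (Suc k)
  have "AE x in lebesgue. w (A *v (matrix_pow A (Suc k) *v x)) \<le> C * w (matrix_pow A (Suc k) *v x)"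
    using AE_lebesgue_matrix[OF invertible_matrix_pow[OF assms(1)] assms(3)] .
  with Suc.IH show ?case
  proof eventually_elim
    case (elim x)
    have "w (matrix_pow A (Suc (Suc k)) *v x) = w (A *v (matrix_pow A (Suc k) *v x))"
      by (simp add: matrix_vector_mul_assoc)
    also have "\<dots> \<le> C * w (matrix_pow A (Suc k) *v x)" by (rule elim(2))
    also have "\<dots> \<le> C * (C ^ k * w (A *v x))"
      using elim(1) assms(2) by (rule mult_left_mono)
    finally show ?case by (simp add: mult.assoc)
  qed
qed simp

section \<open>Cubes and their density in sets of positive measure\<close>

lemma cubeE:
  assumes "Q \<in> (cubes :: (real^'n) set set)"
  obtains a b where "Q = cbox a b" "box a b \<noteq> {}"
  using assms unfolding cubes_def
  by (fastforce simp: interval_ne_empty_cart)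

lemma cube_measure:
  assumes "Q \<in> (cubes :: (real^'n) set set)"
  shows "Q \<in> sets lebesgue" "0 < emeasure lebesgue Q" "emeasure lebesgue Q < \<infinity>"
proof -
  obtain a b where Q: "Q = cbox a b" "box a b \<noteq> {}"
    using cubeE[OF assms] .
  show "Q \<in> sets lebesgue" by (simp add: Q)
  show "emeasure lebesgue Q < \<infinity>"
    using emeasure_lborel_cbox_finite[of a b] by (simp add: Q(1))
  have "\<not> negligible (cbox a b)"
    using Q(2) by (simp add: negligible_interval(1))
  then show "0 < emeasure lebesgue Q"
    using Q(1) by (auto simp: negligible_iff_null_sets null_sets_def zero_less_iff_neq_zero)
qed

text \<open>If all cubes had density below one half, then summing over an almost disjoint cover of
  \<open>S\<close> by cubes inside an open set \<open>T\<close> would bound the measure of \<open>S\<close> by that of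
  \<open>T - S\<close>, which outer regularity makes as small as we like.\<close>

lemma dense_cube:
  fixes E :: "(real^'n) set"
  assumes E: "E \<in> sets lebesgue" and pos: "0 < emeasure lebesgue E"
  obtains Q where "Q \<in> cubes" "emeasure lebesgue Q \<le> 2 * emeasure lebesgue (E \<inter> Q)"
proof (rule ccontr)
  note dense = that
  assume "\<not> thesis"
  then have sparse: "2 * emeasure lebesgue (E \<inter> Q) < emeasure lebesgue Q" if "Q \<in> cubes" for Q
    using dense[OF that] by (meson not_le)
  let ?a = "\<lambda>n::nat. (\<chi> i. - (real n + 1)) :: real^'n" and ?b = "\<lambda>n::nat. (\<chi> i. real n + 1) :: real^'n"
  \<comment> \<open>\<open>E\<close> may have infinite measure. A bounded piece of it has finite
    measure, which the strict estimate for \<open>T - S\<close> below requires.\<close>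
  have "\<exists>n. 0 < emeasure lebesgue (E \<inter> cbox (?a n) (?b n))"
  proof (rule ccontr)
    assume "\<not> (\<exists>n. 0 < emeasure lebesgue (E \<inter> cbox (?a n) (?b n)))"
    then have "(\<Union>n. E \<inter> cbox (?a n) (?b n)) \<in> null_sets lebesgue"
      using E by (intro null_sets_UN) (auto simp: null_sets_def)
    moreover have "E \<subseteq> (\<Union>n. E \<inter> cbox (?a n) (?b n))"
    proof
      fix x assume "x \<in> E"
      obtain n where n: "norm x \<le> real n" using real_arch_simple by blast
      have "\<bar>x $ i\<bar> \<le> real n" for i
        using component_le_norm_cart[of x i] n by linarith
      then have "x \<in> cbox (?a n) (?b n)"
        unfolding mem_box_cart by (auto simp: abs_le_iff) (smt (verit))+
      with \<open>x \<in> E\<close> show "x \<in> (\<Union>n. E \<inter> cbox (?a n) (?b n))" by blast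
    qed
    ultimately have "E \<in> null_sets lebesgue"
      using E null_sets_subset by blast
    with pos show False by (simp add: null_sets_def)
  qed
  then obtain n where n: "0 < emeasure lebesgue (E \<inter> cbox (?a n) (?b n))" by blast
  define a b where "a = ?a n" and "b = ?b n"
  define S where "S = E \<inter> cbox a b"
  have S: "S \<in> sets lebesgue" "0 < emeasure lebesgue S"
    using E n by (auto simp: S_def a_def b_def)
  have "emeasure lebesgue S \<le> emeasure lebesgue (cbox a b)"
    unfolding S_def by (intro emeasure_mono) auto
  then have S_fin: "emeasure lebesgue S < \<infinity>"
    using emeasure_lborel_cbox_finite[of a b] by (simp add: order_le_less_trans)
  then have S_eq: "emeasure lebesgue S = ennreal (measure lebesgue S)"
    by (intro emeasure_eq_ennreal_measure) auto
  \<comment> \<open>The tolerance in outer regularity is the measure of \<open>S\<close> itself;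
    this is positive and finite.\<close>
  then obtain T where T: "open T" "S \<subseteq> T" "T - S \<in> lmeasurable"
      "emeasure lebesgue (T - S) < emeasure lebesgue S"
    using sets_lebesgue_outer_open[OF S(1), of "measure lebesgue S"] S(2) by auto
  \<comment> \<open>Every cell obtained from the covering lemma meets \<open>S\<close>, hence has
    its gauge point in \<open>T\<close>, so this gauge forces the cell to lie in \<open>T\<close>.
    The value \<open>UNIV\<close> merely makes \<open>g\<close> a gauge on the whole space.\<close>
  define g where "g x = (if x \<in> T then T else UNIV)" for x
  have "gauge g" using T(1) by (auto simp: gauge_def g_def)
  have "box a b \<noteq> {}" by (simp add: a_def b_def interval_ne_empty_cart)
  have "S \<subseteq> cbox a b" by (simp add: S_def)
  \<comment> \<open>The cells arise by dyadic subdivision with one exponent \<open>m\<close> for all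
    coordinates. Since \<open>cbox a b\<close> is a cube, each cell is a cube as well.\<close>
  obtain D where D: "countable D" "\<Union>D \<subseteq> cbox a b"
    "\<And>K. K \<in> D \<Longrightarrow> interior K \<noteq> {} \<and> (\<exists>c d. K = cbox c d)"
    "pairwise (\<lambda>A B. interior A \<inter> interior B = {}) D"
    "\<And>K. K \<in> D \<Longrightarrow> \<exists>x \<in> S \<inter> K. K \<subseteq> g x"
    "\<And>u v. cbox u v \<in> D \<Longrightarrow> \<exists>m. \<forall>i \<in> Basis. v \<bullet> i - u \<bullet> i = (b \<bullet> i - a \<bullet> i) / 2^m"
    "S \<subseteq> \<Union>D"
    apply (rule covering_lemma[OF \<open>S \<subseteq> cbox a b\<close> \<open>box a b \<noteq> {}\<close> \<open>gauge g\<close>])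
    subgoal premises prems for D by (rule prems(1)[of D]) (fact prems)+
    done
  have cube: "K \<in> cubes" if K: "K \<in> D" for K
  proof -
    obtain u v where uv: "K = cbox u v" using D(3)[OF K] by blast
    then obtain m where m: "\<forall>i \<in> Basis. v \<bullet> i - u \<bullet> i = (b \<bullet> i - a \<bullet> i) / 2^m"
      using D(6) K by blast
    define l where "l = 2 * (real n + 1) / 2^m"
    have "v $ i = u $ i + l" for i
    proof -
      have "v \<bullet> axis i 1 - u \<bullet> axis i 1 = (b \<bullet> axis i 1 - a \<bullet> axis i 1) / 2^m"
        using m by (auto simp: axis_in_Basis_iff)
      then show ?thesis by (simp add: inner_axis a_def b_def l_def algebra_simps)
    qed
    then have "v = (\<chi> i. u $ i + l)" by (simp add: vec_eq_iff)
    moreover have "0 < l" by (simp add: l_def)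
    ultimately show ?thesis unfolding cubes_def uv by blast
  qed
  have D_sub: "K \<subseteq> T" if "K \<in> D" for K
    using D(5)[OF that] T(2) by (auto simp: g_def split: if_splits)
  \<comment> \<open>Distinct cells may share boundary points, so measures are added over interiors
    and the boundaries are discarded as null sets.\<close>
  have bd: "K - interior K \<in> null_sets lebesgue" if "K \<in> D" for K
  proof -
    obtain c d where "K = cbox c d" using D(3)[OF \<open>K \<in> D\<close>] by blast
    then show ?thesis
      using negligible_frontier_interval[of c d] by (simp add: negligible_iff_null_sets)
  qed
  have disj: "disjoint_family_on (\<lambda>K. F \<inter> interior K) D" for F
    using D(4) by (auto simp: disjoint_family_on_def pairwise_def)
  \<comment> \<open>If \<open>S\<close> filled more than half of a cell, the cell would be a dense
    cube for \<open>E\<close>, contrary to \<open>sparse\<close>.\<close>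
  have half: "emeasure lebesgue (S \<inter> interior K) \<le> emeasure lebesgue ((T - S) \<inter> interior K)"
    if K: "K \<in> D" for K
  proof (rule ccontr)
    assume "\<not> ?thesis"
    then have less: "emeasure lebesgue ((T - S) \<inter> interior K) < emeasure lebesgue (S \<inter> interior K)"
      by simp
    have K_meas: "K \<in> sets lebesgue" using cube_measure(1)[OF cube[OF K]] .
    have int: "interior K = (S \<inter> interior K) \<union> ((T - S) \<inter> interior K)"
      using D_sub[OF K] interior_subset[of K] by auto
    have "emeasure lebesgue K = emeasure lebesgue (interior K \<union> (K - interior K))"
      using interior_subset[of K] by (simp add: Un_absorb1)
    also have "\<dots> = emeasure lebesgue (interior K)"
      using bd[OF K] by (intro emeasure_Un_null_set) auto
    also have "\<dots> = emeasure lebesgue (S \<inter> interior K) + emeasure lebesgue ((T - S) \<inter> interior K)"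
      using S(1) T(3) by (subst int, subst plus_emeasure) (auto intro!: sets.Int)
    also have "\<dots> \<le> emeasure lebesgue (S \<inter> interior K) + emeasure lebesgue (S \<inter> interior K)"
      using less by (intro add_left_mono) simp
    also have "\<dots> = 2 * emeasure lebesgue (S \<inter> interior K)" by (simp add: mult_2)
    also have "\<dots> \<le> 2 * emeasure lebesgue (E \<inter> K)"
      using E K_meas interior_subset[of K]
      by (intro mult_left_mono emeasure_mono) (auto simp: S_def)
    finally show False using sparse[OF cube[OF K]] by simp
  qed
  have cover: "S \<subseteq> (\<Union>K\<in>D. S \<inter> interior K) \<union> (\<Union>K\<in>D. K - interior K)"
    using D(7) by blast
  have null: "(\<Union>K\<in>D. K - interior K) \<in> null_sets lebesgue"
    using bd D(1) by (intro null_sets_UN') auto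
  have inS: "S \<inter> interior K \<in> sets lebesgue" "(T - S) \<inter> interior K \<in> sets lebesgue" for K
    using S(1) T(3) by (auto intro!: sets.Int)
  have UN: "(\<Union>K\<in>D. S \<inter> interior K) \<in> sets lebesgue"
    using D(1) inS by (intro sets.countable_UN') auto
  have "emeasure lebesgue S \<le> emeasure lebesgue ((\<Union>K\<in>D. S \<inter> interior K) \<union> (\<Union>K\<in>D. K - interior K))"
    using cover UN null by (intro emeasure_mono sets.Un) auto
  also have "\<dots> = emeasure lebesgue (\<Union>K\<in>D. S \<inter> interior K)"
    using UN null by (rule emeasure_Un_null_set)
  also have "\<dots> = (\<integral>\<^sup>+K. emeasure lebesgue (S \<inter> interior K) \<partial>count_space D)"
    using D(1) inS disj by (intro emeasure_UN_countable) auto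
  also have "\<dots> \<le> (\<integral>\<^sup>+K. emeasure lebesgue ((T - S) \<inter> interior K) \<partial>count_space D)"
    using half by (intro nn_integral_mono) simp
  also have "\<dots> = emeasure lebesgue (\<Union>K\<in>D. (T - S) \<inter> interior K)"
    using D(1) inS disj by (intro emeasure_UN_countable[symmetric]) auto
  also have "\<dots> \<le> emeasure lebesgue (T - S)"
    using T(3) by (intro emeasure_mono) auto
  also have "\<dots> < emeasure lebesgue S" by (rule T(4))
  finally show False by simp
qed

section \<open>From bounds on averages to pointwise bounds\<close>

text \<open>This is Chebyshev's inequality: \<open>E\<close> fills at least half of
  \<open>Q\<close>, and \<open>ennreal\<close> makes the integrand nonnegative on the rest.\<close>

lemma average_ge_half:
  fixes E Q :: "(real^'n) set"
  assumes E: "E \<in> sets lebesgue" and Q: "Q \<in> cubes"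
    and dense: "emeasure lebesgue Q \<le> 2 * emeasure lebesgue (E \<inter> Q)"
    and f: "\<And>x. x \<in> E \<Longrightarrow> s \<le> f x" and "0 \<le> s"
  shows "ennreal (s / 2) \<le> average Q (\<lambda>x. ennreal (f x))"
proof -
  have "ennreal (s / 2) * emeasure lebesgue Q
      \<le> ennreal (s / 2) * (2 * emeasure lebesgue (E \<inter> Q))"
    using dense by (rule mult_left_mono) simp
  also have "\<dots> = (ennreal (s / 2) * ennreal 2) * emeasure lebesgue (E \<inter> Q)"
    by (simp add: mult.assoc)
  also have "\<dots> = ennreal s * emeasure lebesgue (E \<inter> Q)"
    using \<open>0 \<le> s\<close> by (subst ennreal_mult[symmetric]) auto
  also have "\<dots> = (\<integral>\<^sup>+x. ennreal s * indicator (E \<inter> Q) x \<partial>lebesgue)"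
    using E cube_measure(1)[OF Q] by (intro nn_integral_cmult_indicator[symmetric]) auto
  also have "\<dots> \<le> (\<integral>\<^sup>+x\<in>Q. ennreal (f x) \<partial>lebesgue)"
    using f by (intro nn_integral_mono) (auto simp: indicator_def intro: ennreal_leI)
  finally have "ennreal (s / 2) * emeasure lebesgue Q / emeasure lebesgue Q
      \<le> average Q (\<lambda>x. ennreal (f x))"
    unfolding average_def by (rule divide_right_mono_ennreal)
  then show ?thesis
    using cube_measure(2,3)[OF Q] by (simp add: ennreal_mult_divide_eq)
qed

lemma ennreal_powr_ge:
  assumes "ennreal t \<le> x" "0 \<le> t" "0 \<le> r"
  shows "ennreal (t powr r) \<le> ennreal_powr x r"
proof (cases x)
  case (real y)
  then show ?thesis
    using assms by (auto simp: ennreal_powr_def intro!: ennreal_leI powr_mono2)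
qed (simp add: ennreal_powr_def)

text \<open>If \<open>s < f x\<close> and \<open>t < g x\<close> held on a set of positive measure,
  a dense cube for that set would have averages at least \<open>s / 2\<close> and
  \<open>t / 2\<close>. The factor \<open>2 * 2 powr r\<close> pays for these two halvings.\<close>

lemma AE_le_of_averages:
  fixes f g :: "real^'n \<Rightarrow> real"
  assumes f: "f \<in> borel_measurable lebesgue" and g: "g \<in> borel_measurable lebesgue"
    and "0 < r" "0 < C"
    and avg: "\<And>Q. Q \<in> cubes \<Longrightarrow>
      average Q (\<lambda>x. ennreal (f x)) * ennreal_powr (average Q (\<lambda>x. ennreal (g x))) r \<le> ennreal C"
  shows "AE x in lebesgue. 0 < f x \<longrightarrow> 0 < g x \<longrightarrow> f x * g x powr r \<le> 2 * 2 powr r * C"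
proof -
  let ?D = "2 * 2 powr r * C"
  have "0 < ?D" using \<open>0 < C\<close> by simp
  have null: "AE x in lebesgue. \<not> (s < f x \<and> t < g x)"
    if st: "0 < s" "0 < t" "?D < s * t powr r" for s t
  proof (rule ccontr)
    define E where "E = {x. s < f x \<and> t < g x}"
    have E: "E \<in> sets lebesgue"
    proof -
      note [measurable] = f g
      have "{x \<in> space lebesgue. s < f x \<and> t < g x} \<in> sets lebesgue" by measurable
      then show ?thesis by (simp add: E_def)
    qed
    assume "\<not> (AE x in lebesgue. \<not> (s < f x \<and> t < g x))"
    then have "E \<notin> null_sets lebesgue"
      by (auto simp: E_def intro: AE_I')
    then have "0 < emeasure lebesgue E"
      using E by (auto simp: null_sets_def zero_less_iff_neq_zero)
    then obtain Q where Q: "Q \<in> cubes" "emeasure lebesgue Q \<le> 2 * emeasure lebesgue (E \<inter> Q)"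
      using dense_cube[OF E] by blast
    have "ennreal (s / 2 * (t / 2) powr r) = ennreal (s / 2) * ennreal ((t / 2) powr r)"
      using st by (intro ennreal_mult) auto
    also have "\<dots> \<le> average Q (\<lambda>x. ennreal (f x)) * ennreal_powr (average Q (\<lambda>x. ennreal (g x))) r"
      using st \<open>0 < r\<close>
      by (intro mult_mono average_ge_half[OF E Q] ennreal_powr_ge) (auto simp: E_def)
    also have "\<dots> \<le> ennreal C" by (rule avg[OF Q(1)])
    finally have "s / 2 * (t / 2) powr r \<le> C"
      using \<open>0 < C\<close> by (simp add: ennreal_le_iff)
    then show False
      using st by (simp add: powr_divide field_simps)
  qed
  \<comment> \<open>Rational thresholds leave only countably many exceptional null sets to
    unite.\<close>
  have "AE x in lebesgue. \<forall>s t :: rat. 0 < real_of_rat s \<longrightarrow> 0 < real_of_rat t \<longrightarrow>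
      ?D < real_of_rat s * real_of_rat t powr r \<longrightarrow> \<not> (real_of_rat s < f x \<and> real_of_rat t < g x)"
    unfolding AE_all_countable using null by (auto simp: AE_conj_iff)
  then show ?thesis
  proof eventually_elim
    case (elim x)
    show ?case
    proof (intro impI, rule ccontr)
      assume pos: "0 < f x" "0 < g x" and "\<not> f x * g x powr r \<le> ?D"
      \<comment> \<open>The strict violation leaves room for rationals: first \<open>t\<close> below
        \<open>g x\<close> with \<open>?D < f x * t powr r\<close>, then \<open>s\<close> below
        \<open>f x\<close> with \<open>?D < s * t powr r\<close>.\<close>
      then have "?D / f x < g x powr r" by (simp add: field_simps)
      then have "(?D / f x) powr (1 / r) < (g x powr r) powr (1 / r)"
        using pos \<open>0 < r\<close> \<open>0 < ?D\<close> by (intro powr_less_mono2) auto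
      also have "\<dots> = g x" using pos \<open>0 < r\<close> by (simp add: powr_powr)
      finally obtain t where t: "(?D / f x) powr (1 / r) < real_of_rat t" "real_of_rat t < g x"
        using of_rat_dense by blast
      then have t0: "0 < real_of_rat t" by (smt (verit) powr_ge_zero)
      have "((?D / f x) powr (1 / r)) powr r < real_of_rat t powr r"
        using t(1) \<open>0 < r\<close> by (intro powr_less_mono2) auto
      then have "?D / f x < real_of_rat t powr r"
        using pos \<open>0 < r\<close> \<open>0 < ?D\<close> by (simp add: powr_powr)
      then have "?D / real_of_rat t powr r < f x" using pos t0 by (simp add: field_simps)
      then obtain s where s: "?D / real_of_rat t powr r < real_of_rat s" "real_of_rat s < f x"
        using of_rat_dense by blast
      then have "0 < real_of_rat s"
        using \<open>0 < ?D\<close> by (smt (verit) divide_nonneg_nonneg powr_ge_zero)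
      moreover have "?D < real_of_rat s * real_of_rat t powr r"
        using s(1) t0 by (simp add: field_simps)
      ultimately show False using elim t0 s(2) t(2) by blast
    qed
  qed
qed

section \<open>Weights, comparison of constants, and the pointwise bound\<close>

text \<open>A weight is the pointwise limit of its truncations to growing balls, each of which is
  integrable by local integrability.\<close>

lemma weight_borel_measurable:
  fixes w :: "real^'n \<Rightarrow> real"
  assumes "weight w"
  shows "w \<in> borel_measurable lebesgue"
proof (rule borel_measurable_LIMSEQ_real)
  let ?K = "\<lambda>n::nat. cball (0 :: real^'n) (real n)"
  show "(\<lambda>x. indicat_real (?K n) x *\<^sub>R w x) \<in> borel_measurable lebesgue" for n
  proof -
    have "set_integrable lebesgue (?K n) w"
      using assms by (auto simp: weight_def locally_integrable_def)
    then show ?thesis unfolding set_integrable_def by (rule borel_measurable_integrable)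
  qed
  fix x :: "real^'n"
  obtain m where m: "norm x \<le> real m" using real_arch_simple by blast
  have "indicat_real (?K n) x *\<^sub>R w x = w x" if "m \<le> n" for n
    using m that by (simp add: indicator_def)
  then show "(\<lambda>n. indicat_real (?K n) x *\<^sub>R w x) \<longlonglongrightarrow> w x"
    by (intro tendsto_eventually) (auto simp: eventually_sequentially)
qed

text \<open>The matrix enters only the first average; the dual factor is common to both constants,
  so monotonicity of the integral suffices.\<close>

lemma muckenhoupt_const_le:
  fixes A B :: "real^'n^'n" and w :: "real^'n \<Rightarrow> real"
  assumes meas: "(\<lambda>x. w (A *v x)) \<in> borel_measurable lebesgue" and "0 \<le> c"
    and le: "AE x in lebesgue. w (B *v x) \<le> c * w (A *v x)"
  shows "muckenhoupt_const B p w \<le> ennreal c * muckenhoupt_const A p w"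
  unfolding muckenhoupt_const_def
proof (rule SUP_least)
  let ?av = "\<lambda>A Q. average Q (\<lambda>x. ennreal (w (A *v x)))"
  let ?d = "\<lambda>Q. ennreal_powr (average Q (\<lambda>x. ennreal (w x powr (- 1 / (p - 1))))) (p - 1)"
  fix Q :: "(real^'n) set" assume Q: "Q \<in> cubes"
  note [measurable] = meas cube_measure(1)[OF Q]
  have "(\<integral>\<^sup>+x\<in>Q. ennreal (w (B *v x)) \<partial>lebesgue)
      \<le> (\<integral>\<^sup>+x. ennreal c * (ennreal (w (A *v x)) * indicator Q x) \<partial>lebesgue)"
  proof (rule nn_integral_mono_AE)
    show "AE x in lebesgue. ennreal (w (B *v x)) * indicator Q x
        \<le> ennreal c * (ennreal (w (A *v x)) * indicator Q x)"
      using le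
    proof eventually_elim
      case (elim x)
      \<comment> \<open>\<open>ennreal\<close> sends negative reals to 0, so this also holds where
        \<open>w\<close> is negative; only \<open>c\<close> must be nonnegative.\<close>
      then have "ennreal (w (B *v x)) \<le> ennreal c * ennreal (w (A *v x))"
        using \<open>0 \<le> c\<close> by (simp add: ennreal_mult'[symmetric] ennreal_leI)
      then show ?case by (simp add: indicator_def)
    qed
  qed
  also have "\<dots> = ennreal c * (\<integral>\<^sup>+x\<in>Q. ennreal (w (A *v x)) \<partial>lebesgue)"
    by (rule nn_integral_cmult) measurable
  finally have "?av B Q \<le> ennreal c * ?av A Q"
    unfolding average_def ennreal_times_divide by (rule divide_right_mono_ennreal)
  then have "?av B Q * ?d Q \<le> (ennreal c * ?av A Q) * ?d Q"
    by (rule mult_right_mono) simp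
  also have "\<dots> = ennreal c * (?av A Q * ?d Q)" by (rule mult.assoc)
  also have "\<dots> \<le> ennreal c * (SUP Q\<in>cubes. ?av A Q * ?d Q)"
    using Q by (intro mult_left_mono SUP_upper) auto
  finally show "?av B Q * ?d Q \<le> ennreal c * (SUP Q\<in>cubes. ?av A Q * ?d Q)" .
qed

text \<open>\<open>AE_le_of_averages\<close> is applied to \<open>w\<close> composed with
  \<open>A\<close> and to the dual weight \<open>?g\<close>, with \<open>r = p - 1\<close>. Almost
  everywhere \<open>?g x powr (p - 1)\<close> is \<open>1 / w x\<close>, which turns the product
  bound into a comparison.\<close>

lemma muckenhoupt_mat_AE_le:
  fixes A :: "real^'n^'n"
  assumes "1 < p" "invertible A" "w \<in> muckenhoupt_mat A p"
  shows "\<exists>C>0. AE x in lebesgue. w (A *v x) \<le> C * w x"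
proof -
  have w: "weight w" and fin: "muckenhoupt_const A p w < \<infinity>"
    using assms(3) by (auto simp: muckenhoupt_mat_def)
  note meas = weight_borel_measurable[OF w]
  have wpos: "AE x in lebesgue. 0 < w x" using w by (simp add: weight_def)
  let ?g = "\<lambda>x. w x powr (- 1 / (p - 1))"
  \<comment> \<open>Adding 1 makes the bound strictly positive, as \<open>AE_le_of_averages\<close>
    demands.\<close>
  define M where "M = enn2real (muckenhoupt_const A p w) + 1"
  have "0 < M" by (simp add: M_def add_nonneg_pos)
  have "muckenhoupt_const A p w = ennreal (enn2real (muckenhoupt_const A p w))"
    using fin by simp
  also have "\<dots> \<le> ennreal M" by (intro ennreal_leI) (simp add: M_def)
  finally have M: "muckenhoupt_const A p w \<le> ennreal M" .
  have "AE x in lebesgue. 0 < w (A *v x) \<longrightarrow> 0 < ?g x \<longrightarrow>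
      w (A *v x) * ?g x powr (p - 1) \<le> 2 * 2 powr (p - 1) * M"
  proof (rule AE_le_of_averages)
    show "(\<lambda>x. w (A *v x)) \<in> borel_measurable lebesgue"
      by (rule borel_measurable_lebesgue_matrix[OF assms(2) meas])
    show "?g \<in> borel_measurable lebesgue"
      using meas by measurable
    fix Q :: "(real^'n) set" assume "Q \<in> cubes"
    then have "average Q (\<lambda>x. ennreal (w (A *v x))) * ennreal_powr (average Q (\<lambda>x. ennreal (?g x))) (p - 1)
        \<le> muckenhoupt_const A p w"
      unfolding muckenhoupt_const_def by (rule SUP_upper)
    with M show "average Q (\<lambda>x. ennreal (w (A *v x)))
        * ennreal_powr (average Q (\<lambda>x. ennreal (?g x))) (p - 1) \<le> ennreal M"
      by (rule order_trans[rotated])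
  qed (use assms(1) \<open>0 < M\<close> in auto)
  with wpos AE_lebesgue_matrix[OF assms(2) wpos]
  have "AE x in lebesgue. w (A *v x) \<le> (2 * 2 powr (p - 1) * M) * w x"
  proof eventually_elim
    case (elim x)
    have "?g x powr (p - 1) = w x powr (- 1)"
      unfolding powr_powr using assms(1) by simp
    then have "?g x powr (p - 1) = 1 / w x"
      using elim(1) by (simp add: powr_minus_divide)
    moreover have "0 < ?g x" using elim(1) by simp
    ultimately have "w (A *v x) * (1 / w x) \<le> 2 * 2 powr (p - 1) * M"
      using elim(2,3) by metis
    then show ?case using elim(1) by (simp add: field_simps)
  qed
  moreover have "0 < 2 * 2 powr (p - 1) * M" using \<open>0 < M\<close> by simp
  ultimately show ?thesis by blast
qed

theorem theorem1p4:
  fixes p :: real and A :: "real^'n^'n"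
  assumes "1 < p"
    and "invertible A"
    and "\<exists>k::nat. 1 \<le> k \<and> matrix_pow A k = mat 1"
  shows "muckenhoupt_mat A p =
    {w \<in> muckenhoupt p. \<exists>C>0. AE x in lebesgue. w (A *v x) \<le> C * w x}"
proof (intro set_eqI iffI)
  fix w assume w: "w \<in> muckenhoupt_mat A p"
  then have wt: "weight w" and fin: "muckenhoupt_const A p w < \<infinity>"
    by (auto simp: muckenhoupt_mat_def)
  obtain C where C: "0 < C" "AE x in lebesgue. w (A *v x) \<le> C * w x"
    using muckenhoupt_mat_AE_le[OF assms(1,2) w] by blast
  \<comment> \<open>The exponent is at least 1, hence a successor; the orbit estimate then closes up
    at \<open>x\<close> with constant \<open>C ^ k\<close>.\<close>
  obtain k where "matrix_pow A (Suc k) = mat 1"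
    using assms(3) by (metis Suc_le_D One_nat_def)
  with AE_le_orbit[OF assms(2) _ C(2), of k] C(1)
  have "AE x in lebesgue. w (mat 1 *v x) \<le> C ^ k * w (A *v x)" by simp
  then have "muckenhoupt_const (mat 1) p w \<le> ennreal (C ^ k) * muckenhoupt_const A p w"
    using C(1) borel_measurable_lebesgue_matrix[OF assms(2) weight_borel_measurable[OF wt]]
    by (intro muckenhoupt_const_le) auto
  also have "\<dots> < \<infinity>" using fin by (simp add: ennreal_mult_less_top)
  finally show "w \<in> {w \<in> muckenhoupt p. \<exists>C>0. AE x in lebesgue. w (A *v x) \<le> C * w x}"
    using wt C by (auto simp: muckenhoupt_def muckenhoupt_mat_def)
next
  fix w assume "w \<in> {w \<in> muckenhoupt p. \<exists>C>0. AE x in lebesgue. w (A *v x) \<le> C * w x}"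
  \<comment> \<open>Writing \<open>x\<close> as \<open>mat 1 *v x\<close> fits the bound to
    \<open>muckenhoupt_const_le\<close>, now with the identity as the comparison matrix.\<close>
  then obtain C where C: "0 < C" "AE x in lebesgue. w (A *v x) \<le> C * w (mat 1 *v x)"
    and wt: "weight w" and fin: "muckenhoupt_const (mat 1) p w < \<infinity>"
    by (auto simp: muckenhoupt_def muckenhoupt_mat_def)
  have "muckenhoupt_const A p w \<le> ennreal C * muckenhoupt_const (mat 1) p w"
    using C weight_borel_measurable[OF wt] by (intro muckenhoupt_const_le) auto
  also have "\<dots> < \<infinity>" using fin by (simp add: ennreal_mult_less_top)
  finally show "w \<in> muckenhoupt_mat A p" using wt by (simp add: muckenhoupt_mat_def)
qed

end
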